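(* Suppose that the random measure $G$ satisfies the Ghirlanda-Guerra identities and let $q\in\mathbb{R}$. If $$ \mathbb{E}\Bigl\langle \frac{I(R_{1,2} \geq q)}{(1-G(A(\sigma^1,\sigma^2)))^2} \Bigr\rangle <\infty, \qquad A(\sigma^1,\sigma^2) = \{\sigma : \sigma\cdot \sigma^1 \geq q,\ \sigma\cdot \sigma^2 < q\}, $$ then, with probability one (over the randomness of $G$), $$ G^{\otimes 3}\bigl(\bigl\{(\sigma^1,\sigma^2,\sigma^3) : R_{1,2}\geq q,\ R_{1,3}\geq q,\ R_{2,3}< q\bigr\}\bigr)=0. $$
   Context: $G$ is a random probability measure on the unit ball of a separable Hilbert space $H$; $(\sigma^l)_{l\geq 1}$ is an i.i.d. sequence from $G$; $\langle\cdot\rangle$ is the average with respect to $G^{\otimes\infty}$; $\mathbb{E}$ is the expectation with respect to the randomness of $G$. $R_{l,l'}=\sigma^l\cdot\sigma^{l'}$ is the scalar product (overlap), and $I(\cdot)$ denotes an indicator. The ratio in the hypothesis is understood as $0$ when $R_{1,2}<q$ and as $+\infty$ when $R_{1,2}\ge q$ and $G(A(\sigma^1,\sigma^2))=1$. Ghirlanda-Guerra identities: for any $n\geq 2$, any bounded measurable function $f$ of the overlaps $(R_{l,l'})_{l,l'\leq n}$ and any bounded measurable function $\psi$ of one overlap, $$\mathbb{E}\langle f\psi(R_{1,n+1})\rangle=\frac1n\,\mathbb{E}\langle f\rangle\,\mathbb{E}\langle\psi(R_{1,2})\rangle+\frac1n\sum_{l=2}^n\mathbb{E}\langle f\psi(R_{1,l})\rangle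 .$$ *)

theory Defs
  imports "HOL-Probability.Probability"
begin

text \<open>
  A separable Hilbert space is a type of sort \<open>{real_inner, polish_space}\<close>: the metric of
  \<open>real_inner\<close> is the one induced by the inner product, and \<open>polish_space\<close> adds completeness
  and second countability (equivalently, for metric spaces, separability).
\<close>

definition random_ball_measure ::
    "'w measure \<Rightarrow> ('w \<Rightarrow> 'h::{real_inner, polish_space} measure) \<Rightarrow> bool" where
  "random_ball_measure P G \<longleftrightarrow>
     prob_space P \<and> G \<in> P \<rightarrow>\<^sub>M prob_algebra borel \<and>
     (\<forall>\<omega>\<in>space P. emeasure (G \<omega>) (cball 0 1) = 1)"

text \<open>The law of an i.i.d. family with common law \<open>\<mu>\<close>, indexed by \<open>I\<close>; the infinite
  product is obtained for \<open>I = {1..}\<close>, so that replicas are numbered from 1.\<close>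

definition replicas :: "nat set \<Rightarrow> 'h measure \<Rightarrow> (nat \<Rightarrow> 'h) measure" where
  "replicas I \<mu> = (\<Pi>\<^sub>M l\<in>I. \<mu>)"

definition overlap :: "(nat \<Rightarrow> 'h::real_inner) \<Rightarrow> nat \<Rightarrow> nat \<Rightarrow> real" where
  "overlap \<sigma> l l' = \<sigma> l \<bullet> \<sigma> l'"

definition overlap_array ::
    "nat \<Rightarrow> (nat \<Rightarrow> 'h::real_inner) \<Rightarrow> nat \<times> nat \<Rightarrow> real" where
  "overlap_array n \<sigma> = (\<lambda>(l, l')\<in>{1..n} \<times> {1..n}. overlap \<sigma> l l')"

definition replica_expectation ::
    "'w measure \<Rightarrow> ('w \<Rightarrow> 'h measure) \<Rightarrow> ((nat \<Rightarrow> 'h) \<Rightarrow> real) \<Rightarrow> real" where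
  "replica_expectation P G F = (\<integral>\<omega>. (\<integral>\<sigma>. F \<sigma> \<partial>replicas {1..} (G \<omega>)) \<partial>P)"

definition ghirlanda_guerra ::
    "'w measure \<Rightarrow> ('w \<Rightarrow> 'h::{real_inner, polish_space} measure) \<Rightarrow> bool" where
  "ghirlanda_guerra P G \<longleftrightarrow>
     (\<forall>n\<ge>2. \<forall>f \<in> borel_measurable (\<Pi>\<^sub>M p\<in>{1..n} \<times> {1..n}. (borel :: real measure)).
      \<forall>\<psi> \<in> borel_measurable (borel :: real measure).
        (\<exists>C. \<forall>r. \<bar>f r\<bar> \<le> (C::real)) \<longrightarrow> (\<exists>C. \<forall>x. \<bar>\<psi> x\<bar> \<le> (C::real)) \<longrightarrow>
        replica_expectation P G (\<lambda>\<sigma>. f (overlap_array n \<sigma>) * \<psi> (overlap \<sigma> 1 (n + 1))) =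
          1 / real n * replica_expectation P G (\<lambda>\<sigma>. f (overlap_array n \<sigma>))
                     * replica_expectation P G (\<lambda>\<sigma>. \<psi> (overlap \<sigma> 1 2))
          + 1 / real n * (\<Sum>l=2..n. replica_expectation P G
                            (\<lambda>\<sigma>. f (overlap_array n \<sigma>) * \<psi> (overlap \<sigma> 1 l))))"

definition separating_set :: "real \<Rightarrow> 'h::real_inner \<Rightarrow> 'h \<Rightarrow> 'h set" where
  "separating_set q s1 s2 = {s. s \<bullet> s1 \<ge> q \<and> s \<bullet> s2 < q}"

text \<open>
  In \<^typ>\<open>ennreal\<close> one has \<open>0 / 0 = 0\<close> and \<open>1 / 0 = \<infinity>\<close>, so the quotient below is 0
  whenever the overlap is less than \<open>q\<close>, and infinite when it is at least \<open>q\<close> and the set has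
  full measure.
\<close>

definition separation_ratio ::
    "real \<Rightarrow> 'h::real_inner measure \<Rightarrow> (nat \<Rightarrow> 'h) \<Rightarrow> ennreal" where
  "separation_ratio q \<mu> \<sigma> =
     indicator {q..} (overlap \<sigma> 1 2) / (1 - emeasure \<mu> (separating_set q (\<sigma> 1) (\<sigma> 2)))\<^sup>2"

lemma separation_ratio_eq_0:
  "overlap \<sigma> 1 2 < q \<Longrightarrow> separation_ratio q \<mu> \<sigma> = 0"
  by (simp add: separation_ratio_def)

lemma separation_ratio_eq_top:
  assumes "overlap \<sigma> 1 2 \<ge> q" "emeasure \<mu> (separating_set q (\<sigma> 1) (\<sigma> 2)) = 1"
  shows "separation_ratio q \<mu> \<sigma> = \<infinity>"
  using assms by (simp add: separation_ratio_def ennreal_divide_zero)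

lemma separation_ratio_eq_ennreal:
  assumes "prob_space \<mu>" "overlap \<sigma> 1 2 \<ge> q"
    and "measure \<mu> (separating_set q (\<sigma> 1) (\<sigma> 2)) \<noteq> 1"
  shows "separation_ratio q \<mu> \<sigma> =
    ennreal (1 / (1 - measure \<mu> (separating_set q (\<sigma> 1) (\<sigma> 2)))\<^sup>2)"
proof -
  interpret prob_space \<mu> by fact
  let ?A = "separating_set q (\<sigma> 1) (\<sigma> 2)"
  have lt: "measure \<mu> ?A < 1" using assms(3) prob_le_1[of ?A] by linarith
  have "1 - emeasure \<mu> ?A = ennreal (1 - measure \<mu> ?A)"
    by (simp add: emeasure_eq_measure ennreal_minus flip: ennreal_1)
  then have "(1 - emeasure \<mu> ?A)\<^sup>2 = ennreal ((1 - measure \<mu> ?A)\<^sup>2)"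
    using lt by (simp add: ennreal_power)
  moreover have "1 / ennreal ((1 - measure \<mu> ?A)\<^sup>2) = ennreal (1 / (1 - measure \<mu> ?A)\<^sup>2)"
    using lt by (subst divide_ennreal[symmetric]) auto
  ultimately show ?thesis
    using assms(2) by (simp add: separation_ratio_def)
qed

end

theory Submission imports Defs begin

text \<open>
  Given \<open>\<omega>\<close> and two replicas, let \<open>x = G(A(\<sigma>\<^sup>1, \<sigma>\<^sup>2))\<close>, and let \<open>X\<^sub>a\<close> be the mean of
  \<open>I(R\<^sub>1\<^sub>,\<^sub>2 \<ge> q) x\<^sup>a\<close>. The three-replica event has mean probability \<open>X\<^sub>1\<close>, so the claim is that
  \<open>X\<^sub>1 = 0\<close>.

  Write \<open>g\<^sub>i = G({\<sigma>. \<sigma> \<bullet> \<sigma>\<^sup>i \<ge> q})\<close> and let \<open>p\<close> be the probability of \<open>R\<^sub>1\<^sub>,\<^sub>2 \<ge> q\<close>. The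
  Ghirlanda-Guerra identities with \<open>n = a + 2\<close>, applied to the event that \<open>R\<^sub>1\<^sub>,\<^sub>2 \<ge> q\<close> and
  \<open>\<sigma>\<^sup>3, \<dots>, \<sigma>\<^sup>n\<close> all lie in \<open>A(\<sigma>\<^sup>1, \<sigma>\<^sup>2)\<close>, and to the indicator of \<open>[q, \<infinity>)\<close>, say that
  the mean of \<open>I(R\<^sub>1\<^sub>,\<^sub>2 \<ge> q) x\<^sup>a g\<^sub>1\<close> times \<open>a + 2\<close> is \<open>(p + 1 + a) X\<^sub>a\<close>. The same with
  \<open>A(\<sigma>\<^sup>2, \<sigma>\<^sup>1)\<close>, followed by an exchange of the first two replicas, gives \<open>(p + 1) X\<^sub>a\<close> for
  \<open>g\<^sub>2\<close> in place of \<open>g\<^sub>1\<close> (both are instances of \<open>ghirlanda_guerra_moment\<close>). Since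
  \<open>g\<^sub>1 \<le> g\<^sub>2 + x\<close>, subtraction yields \<open>a X\<^sub>a \<le> (a + 2) X\<^sub>a\<^sub>+\<^sub>1\<close>
  (\<open>separating_moment_growth\<close>), that is, \<open>a (a + 1) X\<^sub>a\<close> is nondecreasing and
  \<open>(a + 1) X\<^sub>a \<ge> 2 X\<^sub>1 / a\<close> for \<open>a \<ge> 1\<close>.

  On the other hand \<open>(1 - x)\<^sup>-\<^sup>2\<close> is the sum of the series of \<open>(a + 1) x\<^sup>a\<close>, so the hypothesis says
  that the series of \<open>(a + 1) X\<^sub>a\<close> converges. As the harmonic series diverges, \<open>X\<^sub>1 = 0\<close>
  (\<open>first_moment_eq_0\<close>).
\<close>

lemma borel_measurable_power_ennreal [measurable (raw)]:
  fixes f :: "'a \<Rightarrow> ennreal"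
  assumes "f \<in> borel_measurable M"
  shows "(\<lambda>x. f x ^ n) \<in> borel_measurable M"
  using assms by (induction n) simp_all

section \<open>Averages over finitely many replicas\<close>

text \<open>
  Given the first two replicas, the replicas with indices in the finite set \<open>J\<close> are independent
  with law \<open>\<mu>\<close>. The index set \<open>I\<close> of the whole family may be infinite.
\<close>
lemma nn_integral_replicas:
  assumes "prob_space \<mu>" and J: "finite J" "1 \<notin> J" "2 \<notin> J" and I: "insert 1 (insert 2 J) \<subseteq> I"
    and \<phi>[measurable]: "\<phi> \<in> borel_measurable (\<mu> \<Otimes>\<^sub>M \<mu>)"
    and \<psi>[measurable]: "\<And>l. l \<in> J \<Longrightarrow> (\<lambda>(S, s). \<psi> l S s) \<in> borel_measurable ((\<mu> \<Otimes>\<^sub>M \<mu>) \<Otimes>\<^sub>M \<mu>)"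
  shows "(\<integral>\<^sup>+\<sigma>. \<phi> (\<sigma> 1, \<sigma> 2) * (\<Prod>l\<in>J. \<psi> l (\<sigma> 1, \<sigma> 2) (\<sigma> l)) \<partial>replicas I \<mu>) =
         (\<integral>\<^sup>+S. \<phi> S * (\<Prod>l\<in>J. \<integral>\<^sup>+s. \<psi> l S s \<partial>\<mu>) \<partial>(\<mu> \<Otimes>\<^sub>M \<mu>))"
proof -
  interpret prob_space \<mu> by fact
  have sigma: "sigma_finite_measure \<mu>" by unfold_locales
  interpret product_prob_space "\<lambda>_::nat. \<mu>" I
    by unfold_locales
  let ?K = "{1, 2} \<union> J"
  let ?F = "\<lambda>\<sigma>. \<phi> (\<sigma> 1, \<sigma> 2) * (\<Prod>l\<in>J. \<psi> l (\<sigma> 1, \<sigma> 2) (\<sigma> l))"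
  have \<psi>_comp: "(\<lambda>\<sigma>. \<psi> l (\<sigma> 1, \<sigma> 2) (\<sigma> l)) \<in> borel_measurable (\<Pi>\<^sub>M i\<in>?K. \<mu>)" if "l \<in> J" for l
    using measurable_compose[OF _ \<psi>[OF that], of "\<lambda>\<sigma>. ((\<sigma> 1, \<sigma> 2), \<sigma> l)" "\<Pi>\<^sub>M i\<in>?K. \<mu>"] that
    by simp
  have [measurable]: "?F \<in> borel_measurable (\<Pi>\<^sub>M i\<in>?K. \<mu>)"
    by (intro borel_measurable_times_ennreal borel_measurable_prod_ennreal \<psi>_comp
          measurable_compose[OF _ \<phi>]) simp_all
  have "(\<integral>\<^sup>+\<sigma>. ?F \<sigma> \<partial>replicas I \<mu>) = (\<integral>\<^sup>+\<sigma>. ?F (restrict \<sigma> ?K) \<partial>(\<Pi>\<^sub>M i\<in>I. \<mu>))"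
    by (simp add: replicas_def)
  also have "\<dots> = (\<integral>\<^sup>+\<sigma>. ?F \<sigma> \<partial>distr (\<Pi>\<^sub>M i\<in>I. \<mu>) (\<Pi>\<^sub>M i\<in>?K. \<mu>) (\<lambda>\<sigma>. restrict \<sigma> ?K))"
    using I by (intro nn_integral_distr[symmetric] measurable_restrict_subset) auto
  also have "\<dots> = (\<integral>\<^sup>+\<sigma>. ?F \<sigma> \<partial>(\<Pi>\<^sub>M i\<in>?K. \<mu>))"
    using I J by (subst distr_PiM_restrict_finite) auto
  also have "\<dots> = (\<integral>\<^sup>+\<sigma>. \<integral>\<^sup>+\<tau>. ?F (merge {1, 2} J (\<sigma>, \<tau>)) \<partial>(\<Pi>\<^sub>M i\<in>J. \<mu>) \<partial>(\<Pi>\<^sub>M i\<in>{1, 2}. \<mu>))"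
    using J by (intro product_nn_integral_fold) auto
  also have "\<dots> = (\<integral>\<^sup>+\<sigma>. \<phi> (\<sigma> 1, \<sigma> 2) * (\<Prod>l\<in>J. \<integral>\<^sup>+s. \<psi> l (\<sigma> 1, \<sigma> 2) s \<partial>\<mu>) \<partial>(\<Pi>\<^sub>M i\<in>{1::nat, 2}. \<mu>))"
  proof (intro nn_integral_cong)
    fix \<sigma> assume \<sigma>: "\<sigma> \<in> space (\<Pi>\<^sub>M i\<in>{1::nat, 2}. \<mu>)"
    then have S: "(\<sigma> 1, \<sigma> 2) \<in> space (\<mu> \<Otimes>\<^sub>M \<mu>)"
      by (auto simp: space_PiM space_pair_measure PiE_def Pi_def)
    have \<psi>_sec: "\<psi> l (\<sigma> 1, \<sigma> 2) \<in> borel_measurable \<mu>" if "l \<in> J" for l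
      using measurable_compose[OF measurable_Pair1'[OF S] \<psi>[OF that]] by simp
    have comp: "(\<lambda>\<tau>. \<psi> l (\<sigma> 1, \<sigma> 2) (\<tau> l)) \<in> borel_measurable (\<Pi>\<^sub>M i\<in>J. \<mu>)" if "l \<in> J" for l
      by (rule measurable_compose[where f="\<lambda>\<tau>. \<tau> l", OF _ \<psi>_sec[OF that]]) (use that in simp)
    have "(\<integral>\<^sup>+\<tau>. ?F (merge {1, 2} J (\<sigma>, \<tau>)) \<partial>(\<Pi>\<^sub>M i\<in>J. \<mu>)) =
          (\<integral>\<^sup>+\<tau>. \<phi> (\<sigma> 1, \<sigma> 2) * (\<Prod>l\<in>J. \<psi> l (\<sigma> 1, \<sigma> 2) (\<tau> l)) \<partial>(\<Pi>\<^sub>M i\<in>J. \<mu>))"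
      using J by (intro nn_integral_cong arg_cong2[where f="(*)"] prod.cong) (auto simp: merge_def)
    also have "\<dots> = \<phi> (\<sigma> 1, \<sigma> 2) * (\<integral>\<^sup>+\<tau>. (\<Prod>l\<in>J. \<psi> l (\<sigma> 1, \<sigma> 2) (\<tau> l)) \<partial>(\<Pi>\<^sub>M i\<in>J. \<mu>))"
      by (intro nn_integral_cmult borel_measurable_prod_ennreal comp)
    also have "\<dots> = \<phi> (\<sigma> 1, \<sigma> 2) * (\<Prod>l\<in>J. \<integral>\<^sup>+s. \<psi> l (\<sigma> 1, \<sigma> 2) s \<partial>\<mu>)"
      by (simp only: product_nn_integral_prod[where f="\<lambda>l. \<psi> l (\<sigma> 1, \<sigma> 2)", OF J(1) \<psi>_sec])
    finally show "(\<integral>\<^sup>+\<tau>. ?F (merge {1, 2} J (\<sigma>, \<tau>)) \<partial>(\<Pi>\<^sub>M i\<in>J. \<mu>)) =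
      \<phi> (\<sigma> 1, \<sigma> 2) * (\<Prod>l\<in>J. \<integral>\<^sup>+s. \<psi> l (\<sigma> 1, \<sigma> 2) s \<partial>\<mu>)" .
  qed
  also have "\<dots> = (\<integral>\<^sup>+S. \<phi> (fst S, snd S) * (\<Prod>l\<in>J. \<integral>\<^sup>+s. \<psi> l (fst S, snd S) s \<partial>\<mu>) \<partial>(\<mu> \<Otimes>\<^sub>M \<mu>))"
  proof (rule product_nn_integral_pair)
    have "(\<lambda>S. \<phi> S * (\<Prod>l\<in>J. \<integral>\<^sup>+s. \<psi> l S s \<partial>\<mu>)) \<in> borel_measurable (\<mu> \<Otimes>\<^sub>M \<mu>)"
      by (intro borel_measurable_times_ennreal \<phi> borel_measurable_prod_ennreal
            sigma_finite_measure.borel_measurable_nn_integral[OF sigma] \<psi>)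
    then show "(\<lambda>(s1, s2). \<phi> (s1, s2) * (\<Prod>l\<in>J. \<integral>\<^sup>+s. \<psi> l (s1, s2) s \<partial>\<mu>))
        \<in> borel_measurable (\<mu> \<Otimes>\<^sub>M \<mu>)"
      by (simp add: case_prod_beta)
  qed simp
  finally show ?thesis
    by simp
qed

text \<open>
  The average over the randomness of the measure and over two replicas \<open>S = (\<sigma>\<^sup>1, \<sigma>\<^sup>2)\<close>. The
  integrand may depend on the realisation \<open>\<omega>\<close>; all further replicas enter through their
  conditional probabilities given \<open>\<omega>\<close> and \<open>S\<close>.
\<close>
definition pair_mean ::
    "'w measure \<Rightarrow> ('w \<Rightarrow> 'h measure) \<Rightarrow> ('w \<Rightarrow> 'h \<times> 'h \<Rightarrow> ennreal) \<Rightarrow> ennreal" where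
  "pair_mean P G k = (\<integral>\<^sup>+\<omega>. \<integral>\<^sup>+S. k \<omega> S \<partial>(G \<omega> \<Otimes>\<^sub>M G \<omega>) \<partial>P)"

lemma random_ball_measureD:
  assumes "random_ball_measure P G"
  shows "prob_space P" "G \<in> P \<rightarrow>\<^sub>M prob_algebra borel"
    "\<omega> \<in> space P \<Longrightarrow> prob_space (G \<omega>)" "\<omega> \<in> space P \<Longrightarrow> sets (G \<omega>) = sets borel"
proof -
  show *: "prob_space P" "G \<in> P \<rightarrow>\<^sub>M prob_algebra borel"
    using assms by (auto simp: random_ball_measure_def)
  show "\<omega> \<in> space P \<Longrightarrow> prob_space (G \<omega>)" "\<omega> \<in> space P \<Longrightarrow> sets (G \<omega>) = sets borel"
    using measurable_space[OF *(2)] by (auto simp: space_prob_algebra)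
qed

context
  fixes P :: "'w measure" and G :: "'w \<Rightarrow> 'h::{real_inner, polish_space} measure"
  assumes RBM: "random_ball_measure P G"
begin

lemma pair_kernel: "(\<lambda>\<omega>. G \<omega> \<Otimes>\<^sub>M G \<omega>) \<in> P \<rightarrow>\<^sub>M prob_algebra (borel \<Otimes>\<^sub>M borel)"
  using random_ball_measureD(2)[OF RBM] by (intro measurable_pair_prob)

lemma pair_kernelD:
  assumes "\<omega> \<in> space P"
  shows "prob_space (G \<omega> \<Otimes>\<^sub>M G \<omega>)" "sets (G \<omega> \<Otimes>\<^sub>M G \<omega>) = sets (borel \<Otimes>\<^sub>M borel)"
  using measurable_space[OF pair_kernel assms] by (auto simp: space_prob_algebra)

lemma pair_integral_measurable:
  assumes "(\<lambda>(\<omega>, S). k \<omega> S) \<in> borel_measurable (P \<Otimes>\<^sub>M (borel \<Otimes>\<^sub>M borel))"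
  shows "(\<lambda>\<omega>. \<integral>\<^sup>+S. k \<omega> S \<partial>(G \<omega> \<Otimes>\<^sub>M G \<omega>)) \<in> borel_measurable P"
  by (rule nn_integral_measurable_subprob_algebra2[OF assms measurable_prob_algebraD[OF pair_kernel]])

lemma pair_section_measurable:
  assumes k: "(\<lambda>(\<omega>, S). k \<omega> S) \<in> borel_measurable (P \<Otimes>\<^sub>M (borel \<Otimes>\<^sub>M borel))" and \<omega>: "\<omega> \<in> space P"
  shows "k \<omega> \<in> borel_measurable (G \<omega> \<Otimes>\<^sub>M G \<omega>)"
proof -
  have "k \<omega> \<in> borel_measurable (borel \<Otimes>\<^sub>M borel)"
    using measurable_compose[OF measurable_Pair1'[OF \<omega>] k] by simp
  then show ?thesis
    using measurable_cong_sets[OF pair_kernelD(2)[OF \<omega>] refl] by auto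
qed

lemma pair_mean_mono:
  "(\<And>\<omega> S. \<omega> \<in> space P \<Longrightarrow> k \<omega> S \<le> k' \<omega> S) \<Longrightarrow> pair_mean P G k \<le> pair_mean P G k'"
  unfolding pair_mean_def by (intro nn_integral_mono) auto

lemma pair_mean_le_1:
  assumes "\<And>\<omega> S. \<omega> \<in> space P \<Longrightarrow> k \<omega> S \<le> 1"
  shows "pair_mean P G k \<le> 1"
proof -
  interpret P: prob_space P by (rule random_ball_measureD(1)[OF RBM])
  have "(\<integral>\<^sup>+S. k \<omega> S \<partial>(G \<omega> \<Otimes>\<^sub>M G \<omega>)) \<le> 1" if "\<omega> \<in> space P" for \<omega>
  proof -
    interpret prob_space "G \<omega> \<Otimes>\<^sub>M G \<omega>" by (rule pair_kernelD(1)[OF that])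
    have "(\<integral>\<^sup>+S. k \<omega> S \<partial>(G \<omega> \<Otimes>\<^sub>M G \<omega>)) \<le> (\<integral>\<^sup>+S. 1 \<partial>(G \<omega> \<Otimes>\<^sub>M G \<omega>))"
      using assms[OF that] by (intro nn_integral_mono)
    then show ?thesis
      by (simp add: emeasure_space_1)
  qed
  then have "pair_mean P G k \<le> (\<integral>\<^sup>+\<omega>. 1 \<partial>P)"
    unfolding pair_mean_def by (intro nn_integral_mono)
  then show ?thesis
    by (simp add: P.emeasure_space_1)
qed

lemma pair_mean_add:
  assumes "(\<lambda>(\<omega>, S). k \<omega> S) \<in> borel_measurable (P \<Otimes>\<^sub>M (borel \<Otimes>\<^sub>M borel))"
    and "(\<lambda>(\<omega>, S). k' \<omega> S) \<in> borel_measurable (P \<Otimes>\<^sub>M (borel \<Otimes>\<^sub>M borel))"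
  shows "pair_mean P G (\<lambda>\<omega> S. k \<omega> S + k' \<omega> S) = pair_mean P G k + pair_mean P G k'"
proof -
  have "pair_mean P G (\<lambda>\<omega> S. k \<omega> S + k' \<omega> S) =
      (\<integral>\<^sup>+\<omega>. (\<integral>\<^sup>+S. k \<omega> S \<partial>(G \<omega> \<Otimes>\<^sub>M G \<omega>)) + (\<integral>\<^sup>+S. k' \<omega> S \<partial>(G \<omega> \<Otimes>\<^sub>M G \<omega>)) \<partial>P)"
    unfolding pair_mean_def
    by (intro nn_integral_cong nn_integral_add pair_section_measurable assms)
  then show ?thesis
    by (simp add: pair_mean_def nn_integral_add pair_integral_measurable assms)
qed

lemma pair_mean_weighted_sum:
  assumes k: "\<And>i. (\<lambda>(\<omega>, S). k i \<omega> S) \<in> borel_measurable (P \<Otimes>\<^sub>M (borel \<Otimes>\<^sub>M borel))"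
  shows "pair_mean P G (\<lambda>\<omega> S. \<Sum>i\<in>I. c i * k i \<omega> S) = (\<Sum>i\<in>I. c i * pair_mean P G (k i))"
proof -
  have *: "(\<lambda>S. c i * k i \<omega> S) \<in> borel_measurable (G \<omega> \<Otimes>\<^sub>M G \<omega>)" if "\<omega> \<in> space P" for i \<omega>
    by (intro borel_measurable_times_ennreal borel_measurable_const pair_section_measurable k that)
  have "pair_mean P G (\<lambda>\<omega> S. \<Sum>i\<in>I. c i * k i \<omega> S) =
      (\<integral>\<^sup>+\<omega>. (\<Sum>i\<in>I. c i * (\<integral>\<^sup>+S. k i \<omega> S \<partial>(G \<omega> \<Otimes>\<^sub>M G \<omega>))) \<partial>P)"
    unfolding pair_mean_def
    by (intro nn_integral_cong)
      (simp add: nn_integral_sum * nn_integral_cmult[OF pair_section_measurable[OF k]])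
  also have "\<dots> = (\<Sum>i\<in>I. c i * pair_mean P G (k i))"
    unfolding pair_mean_def
    by (subst nn_integral_sum)
      (auto intro!: sum.cong nn_integral_cmult borel_measurable_times_ennreal pair_integral_measurable k)
  finally show ?thesis .
qed

text \<open>The two replicas are exchangeable.\<close>
lemma pair_mean_swap:
  assumes k: "(\<lambda>(\<omega>, S). k \<omega> S) \<in> borel_measurable (P \<Otimes>\<^sub>M (borel \<Otimes>\<^sub>M borel))"
  shows "pair_mean P G (\<lambda>\<omega> S. k \<omega> (snd S, fst S)) = pair_mean P G k"
  unfolding pair_mean_def
proof (rule nn_integral_cong)
  fix \<omega> assume \<omega>: "\<omega> \<in> space P"
  interpret prob_space "G \<omega>" by (rule random_ball_measureD(3)[OF RBM \<omega>])
  interpret pair_sigma_finite "G \<omega>" "G \<omega>" by unfold_locales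
  note [measurable] = pair_section_measurable[OF k \<omega>]
  have "(\<integral>\<^sup>+S. k \<omega> S \<partial>(G \<omega> \<Otimes>\<^sub>M G \<omega>)) =
      (\<integral>\<^sup>+S. k \<omega> S \<partial>distr (G \<omega> \<Otimes>\<^sub>M G \<omega>) (G \<omega> \<Otimes>\<^sub>M G \<omega>) (\<lambda>(x, y). (y, x)))"
    using distr_pair_swap by simp
  also have "\<dots> = (\<integral>\<^sup>+S. k \<omega> (snd S, fst S) \<partial>(G \<omega> \<Otimes>\<^sub>M G \<omega>))"
    by (subst nn_integral_distr) (auto simp: case_prod_beta)
  finally show "(\<integral>\<^sup>+S. k \<omega> (snd S, fst S) \<partial>(G \<omega> \<Otimes>\<^sub>M G \<omega>)) = (\<integral>\<^sup>+S. k \<omega> S \<partial>(G \<omega> \<Otimes>\<^sub>M G \<omega>))"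
    by simp
qed

lemma measurable_conditional_probability:
  fixes A :: "'h \<times> 'h \<Rightarrow> 'h \<Rightarrow> bool"
  assumes A: "Measurable.pred ((borel \<Otimes>\<^sub>M borel) \<Otimes>\<^sub>M borel) (\<lambda>(S, s). A S s)"
  shows "(\<lambda>(\<omega>, S). emeasure (G \<omega>) {s. A S s}) \<in> borel_measurable (P \<Otimes>\<^sub>M (borel \<Otimes>\<^sub>M borel))"
proof -
  have [measurable]: "G \<in> P \<rightarrow>\<^sub>M subprob_algebra borel"
    using random_ball_measureD(2)[OF RBM] by (rule measurable_prob_algebraD)
  let ?M = "P \<Otimes>\<^sub>M (borel \<Otimes>\<^sub>M borel) :: ('w \<times> 'h \<times> 'h) measure"
  have "Measurable.pred (?M \<Otimes>\<^sub>M borel) (\<lambda>z. A (snd (fst z)) (snd z))"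
    using measurable_compose[OF _ A, of "\<lambda>z. (snd (fst z), snd z)" "?M \<Otimes>\<^sub>M borel"] by simp
  then have "{z \<in> space (?M \<Otimes>\<^sub>M borel). A (snd (fst z)) (snd z)} \<in> sets (?M \<Otimes>\<^sub>M borel)"
    by simp
  also have "{z \<in> space (?M \<Otimes>\<^sub>M borel). A (snd (fst z)) (snd z)} =
      (SIGMA x:space ?M. {s. A (snd x) s})"
    by (auto simp: space_pair_measure)
  finally have "(\<lambda>x. emeasure (G (fst x)) {s. A (snd x) s}) \<in> borel_measurable ?M"
    by (rule emeasure_measurable_subprob_algebra2) measurable
  then show ?thesis
    by (simp add: case_prod_beta)
qed

text \<open>
  An event on finitely many replicas that, given the first two, constrains the others
  separately.
\<close>
lemma replica_expectation_event:
  fixes \<phi> :: "'h \<times> 'h \<Rightarrow> bool" and A :: "nat \<Rightarrow> 'h \<times> 'h \<Rightarrow> 'h \<Rightarrow> bool"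
  assumes J: "finite J" "J \<subseteq> {3..}"
    and \<phi>[measurable]: "Measurable.pred (borel \<Otimes>\<^sub>M borel) \<phi>"
    and A: "\<And>l. l \<in> J \<Longrightarrow> Measurable.pred ((borel \<Otimes>\<^sub>M borel) \<Otimes>\<^sub>M borel) (\<lambda>(S, s). A l S s)"
  shows "replica_expectation P G (\<lambda>\<sigma>. of_bool (\<phi> (\<sigma> 1, \<sigma> 2) \<and> (\<forall>l\<in>J. A l (\<sigma> 1, \<sigma> 2) (\<sigma> l)))) =
    enn2real (pair_mean P G (\<lambda>\<omega> S. of_bool (\<phi> S) * (\<Prod>l\<in>J. emeasure (G \<omega>) {s. A l S s})))"
proof -
  let ?e = "\<lambda>\<sigma>. \<phi> (\<sigma> 1, \<sigma> 2) \<and> (\<forall>l\<in>J. A l (\<sigma> 1, \<sigma> 2) (\<sigma> l))"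
  let ?k = "\<lambda>\<omega> S. of_bool (\<phi> S) * (\<Prod>l\<in>J. emeasure (G \<omega>) {s. A l S s})"
  let ?m = "\<lambda>\<omega>. \<integral>\<^sup>+S. ?k \<omega> S \<partial>(G \<omega> \<Otimes>\<^sub>M G \<omega>)"
  interpret P: prob_space P by (rule random_ball_measureD(1)[OF RBM])
  have k: "(\<lambda>(\<omega>, S). ?k \<omega> S) \<in> borel_measurable (P \<Otimes>\<^sub>M (borel \<Otimes>\<^sub>M borel))"
    using borel_measurable_prod_ennreal[of J "\<lambda>l (\<omega>, S). emeasure (G \<omega>) {s. A l S s}",
        OF measurable_conditional_probability[OF A]]
    by (simp add: case_prod_beta)
  note [measurable] = pair_integral_measurable[OF k]
  have inner: "(\<integral>\<sigma>. of_bool (?e \<sigma>) \<partial>replicas {1..} (G \<omega>)) = enn2real (?m \<omega>)" and fin: "?m \<omega> \<le> 1"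
    if \<omega>: "\<omega> \<in> space P" for \<omega>
  proof -
    interpret G: prob_space "G \<omega>" by (rule random_ball_measureD(3)[OF RBM \<omega>])
    interpret GG: prob_space "G \<omega> \<Otimes>\<^sub>M G \<omega>" by (rule pair_kernelD(1)[OF \<omega>])
    note sG[measurable_cong] = random_ball_measureD(4)[OF RBM \<omega>]
    have sP: "sets (\<Pi>\<^sub>M l\<in>{1..}. G \<omega>) = sets (\<Pi>\<^sub>M l\<in>{1..}. borel)"
      by (intro sets_PiM_cong) (auto simp: sG)
    have \<phi>': "\<phi> \<in> measurable (G \<omega> \<Otimes>\<^sub>M G \<omega>) (count_space UNIV)"
      by measurable
    have A': "Measurable.pred ((G \<omega> \<Otimes>\<^sub>M G \<omega>) \<Otimes>\<^sub>M G \<omega>) (\<lambda>(S, s). A l S s)" if "l \<in> J" for l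
      using A[OF that] by measurable
    have comp: "Measurable.pred (\<Pi>\<^sub>M l\<in>{1..}. G \<omega>) (\<lambda>\<sigma>. A l (\<sigma> 1, \<sigma> 2) (\<sigma> l))" if "l \<in> J" for l
      using measurable_compose[OF _ A'[OF that], of "\<lambda>\<sigma>. ((\<sigma> 1, \<sigma> 2), \<sigma> l)" "\<Pi>\<^sub>M l\<in>{1..}. G \<omega>"] J that
      by auto
    have comp\<phi>: "Measurable.pred (\<Pi>\<^sub>M l\<in>{1::nat..}. G \<omega>) (\<lambda>\<sigma>. \<phi> (\<sigma> 1, \<sigma> 2))"
      using measurable_compose[OF _ \<phi>', of "\<lambda>\<sigma>. (\<sigma> 1, \<sigma> 2)" "\<Pi>\<^sub>M l\<in>{1::nat..}. G \<omega>"] by auto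
    have e[measurable]: "Measurable.pred (\<Pi>\<^sub>M l\<in>{1..}. G \<omega>) ?e"
      using J by (intro pred_intros_logic pred_intros_finite comp comp\<phi>) auto
    have "(\<integral>\<^sup>+\<sigma>. ennreal (of_bool (?e \<sigma>)) \<partial>replicas {1..} (G \<omega>)) =
        (\<integral>\<^sup>+\<sigma>. of_bool (\<phi> (\<sigma> 1, \<sigma> 2)) * (\<Prod>l\<in>J. of_bool (A l (\<sigma> 1, \<sigma> 2) (\<sigma> l))) \<partial>replicas {1..} (G \<omega>))"
      using J by (intro nn_integral_cong) (auto simp: of_bool_def prod_zero_iff)
    also have "\<dots> = (\<integral>\<^sup>+S. of_bool (\<phi> S) * (\<Prod>l\<in>J. \<integral>\<^sup>+s. of_bool (A l S s) \<partial>G \<omega>) \<partial>(G \<omega> \<Otimes>\<^sub>M G \<omega>))"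
    proof (rule nn_integral_replicas)
      show "(\<lambda>(S, s). of_bool (A l S s) :: ennreal) \<in> borel_measurable ((G \<omega> \<Otimes>\<^sub>M G \<omega>) \<Otimes>\<^sub>M G \<omega>)"
        if "l \<in> J" for l
        using A'[OF that] by (simp add: case_prod_beta)
    qed (use J in \<open>auto simp: G.prob_space_axioms\<close>)
    also have "\<dots> = ?m \<omega>"
    proof (intro nn_integral_cong arg_cong2[where f="(*)"] prod.cong refl)
      fix S l assume S: "S \<in> space (G \<omega> \<Otimes>\<^sub>M G \<omega>)" and l: "l \<in> J"
      have "Measurable.pred borel (A l S)"
        using measurable_compose[OF measurable_Pair1' A[OF l], of S] by (simp add: space_pair_measure)
      then have "{s. A l S s} \<in> sets (G \<omega>)"
        by (simp add: sG pred_def)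
      then have "emeasure (G \<omega>) {s. A l S s} = (\<integral>\<^sup>+s. indicator {s. A l S s} s \<partial>G \<omega>)"
        by simp
      then show "(\<integral>\<^sup>+s. of_bool (A l S s) \<partial>G \<omega>) = emeasure (G \<omega>) {s. A l S s}"
        by (simp add: indicator_def)
    qed
    finally have *: "(\<integral>\<^sup>+\<sigma>. ennreal (of_bool (?e \<sigma>)) \<partial>replicas {1..} (G \<omega>)) = ?m \<omega>" .
    show "(\<integral>\<sigma>. of_bool (?e \<sigma>) \<partial>replicas {1..} (G \<omega>)) = enn2real (?m \<omega>)"
      unfolding *[symmetric] replicas_def
      by (rule integral_eq_nn_integral[OF measurable_compose[OF e measurable_of_bool]]) simp
    have "?m \<omega> \<le> (\<integral>\<^sup>+S. 1 \<partial>(G \<omega> \<Otimes>\<^sub>M G \<omega>))"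
    proof (intro nn_integral_mono)
      fix S
      have "?k \<omega> S \<le> 1 * 1"
        by (intro mult_mono prod_le_1) (auto simp: G.emeasure_le_1)
      then show "?k \<omega> S \<le> 1" by simp
    qed
    then show "?m \<omega> \<le> 1"
      by (simp add: GG.emeasure_space_1)
  qed
  have "replica_expectation P G (\<lambda>\<sigma>. of_bool (?e \<sigma>)) = (\<integral>\<omega>. enn2real (?m \<omega>) \<partial>P)"
    unfolding replica_expectation_def by (intro Bochner_Integration.integral_cong inner) auto
  also have "\<dots> = enn2real (\<integral>\<^sup>+\<omega>. ennreal (enn2real (?m \<omega>)) \<partial>P)"
    by (rule integral_eq_nn_integral) auto
  also have "(\<integral>\<^sup>+\<omega>. ennreal (enn2real (?m \<omega>)) \<partial>P) = (\<integral>\<^sup>+\<omega>. ?m \<omega> \<partial>P)"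
  proof (intro nn_integral_cong)
    fix \<omega> assume "\<omega> \<in> space P"
    then have "?m \<omega> < top"
      using fin[of \<omega>] order_le_less_trans[OF _ ennreal_one_less_top] by blast
    then show "ennreal (enn2real (?m \<omega>)) = ?m \<omega>" by simp
  qed
  finally show ?thesis
    by (simp add: pair_mean_def)
qed


end

section \<open>Moments of the separating probability\<close>

text \<open>
  The conditional probability, given the replicas \<open>S = (\<sigma>\<^sup>1, \<sigma>\<^sup>2)\<close>, that the overlaps of a
  further replica with \<open>\<sigma>\<^sup>1\<close> and \<open>\<sigma>\<^sup>2\<close> satisfy \<open>A\<close>.
\<close>
definition fresh_prob :: "'h::real_inner measure \<Rightarrow> (real \<Rightarrow> real \<Rightarrow> bool) \<Rightarrow> 'h \<times> 'h \<Rightarrow> ennreal" where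
  "fresh_prob \<mu> A S = emeasure \<mu> {s. A (fst S \<bullet> s) (snd S \<bullet> s)}"

lemma fresh_prob_swap: "fresh_prob \<mu> A (snd S, fst S) = fresh_prob \<mu> (\<lambda>u v. A v u) S"
  by (simp add: fresh_prob_def)

lemma emeasure_separating_set:
  "emeasure \<mu> (separating_set q (fst S) (snd S)) = fresh_prob \<mu> (\<lambda>u v. q \<le> u \<and> v < q) S"
  by (simp add: fresh_prob_def separating_set_def inner_commute)

lemma pred_two_overlaps:
  fixes A :: "real \<Rightarrow> real \<Rightarrow> bool"
  assumes "Measurable.pred (borel \<Otimes>\<^sub>M borel) (\<lambda>(u, v). A u v)"
  shows "Measurable.pred ((borel \<Otimes>\<^sub>M borel) \<Otimes>\<^sub>M borel)
    (\<lambda>(S, s :: 'h::{real_inner, second_countable_topology}). A (fst S \<bullet> s) (snd S \<bullet> s))"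
proof -
  have "(\<lambda>z :: ('h \<times> 'h) \<times> 'h. (fst (fst z) \<bullet> snd z, snd (fst z) \<bullet> snd z))
      \<in> (borel \<Otimes>\<^sub>M borel) \<Otimes>\<^sub>M borel \<rightarrow>\<^sub>M borel \<Otimes>\<^sub>M borel"
    by measurable
  from measurable_compose[OF this assms] show ?thesis
    by (simp add: case_prod_beta)
qed

context
  fixes P :: "'w measure" and G :: "'w \<Rightarrow> 'h::{real_inner, polish_space} measure"
  assumes RBM: "random_ball_measure P G"
begin

lemma measurable_fresh_prob:
  assumes "Measurable.pred (borel \<Otimes>\<^sub>M borel) (\<lambda>(u, v). A u v)"
  shows "(\<lambda>x. fresh_prob (G (fst x)) A (snd x)) \<in> borel_measurable (P \<Otimes>\<^sub>M (borel \<Otimes>\<^sub>M borel))"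
  using measurable_conditional_probability[OF RBM pred_two_overlaps[OF assms]]
  by (simp add: fresh_prob_def case_prod_beta)

text \<open>
  Here the identities are used with \<open>n = a + 2\<close>, for the event that \<open>R\<^sub>1\<^sub>,\<^sub>2 \<ge> q\<close> and that
  each of the replicas \<open>3, \<dots>, n\<close> satisfies \<open>A\<close>; the test function of the new overlap is
  \<open>I(\<cdot> \<ge> q)\<close>. On this event the number of \<open>l\<close> in \<open>{2..n}\<close> with \<open>R\<^sub>1\<^sub>,\<^sub>l \<ge> q\<close> is
  \<open>a + 1\<close> or \<open>1\<close>, according to whether \<open>A\<close> entails \<open>R\<^sub>1\<^sub>,\<^sub>l \<ge> q\<close> or its negation.
\<close>
lemma ghirlanda_guerra_moment:
  fixes A :: "real \<Rightarrow> real \<Rightarrow> bool" and a :: nat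
  assumes GG: "ghirlanda_guerra P G"
    and A[measurable]: "Measurable.pred (borel \<Otimes>\<^sub>M borel) (\<lambda>(u, v). A u v)"
    and b: "\<And>u v. A u v \<Longrightarrow> q \<le> u \<longleftrightarrow> b"
  shows "real (a + 2) * enn2real (pair_mean P G (\<lambda>\<omega> S. of_bool (q \<le> fst S \<bullet> snd S) *
            (fresh_prob (G \<omega>) A S ^ a * fresh_prob (G \<omega>) (\<lambda>u v. q \<le> u) S))) =
         (replica_expectation P G (\<lambda>\<sigma>. of_bool (q \<le> overlap \<sigma> 1 2)) + 1 + (if b then real a else 0)) *
         enn2real (pair_mean P G (\<lambda>\<omega> S. of_bool (q \<le> fst S \<bullet> snd S) * fresh_prob (G \<omega>) A S ^ a))"
    (is "_ * ?U = (?p + 1 + _) * ?X")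
proof -
  define n where "n = a + 2"
  let ?\<psi> = "\<lambda>x::real. of_bool (q \<le> x) :: real"
  define f :: "(nat \<times> nat \<Rightarrow> real) \<Rightarrow> real" where
    "f = (\<lambda>r. of_bool (q \<le> r (1, 2) \<and> (\<forall>l\<in>{3..n}. A (r (1, l)) (r (2, l)))))"
  let ?M = "\<Pi>\<^sub>M p\<in>{1..n} \<times> {1..n}. (borel :: real measure)"
  have n2: "2 \<le> n" by (simp add: n_def)
  have [measurable]: "(\<lambda>r. r (i, l)) \<in> borel_measurable ?M" if "i \<in> {1, 2}" "l \<in> {2..n}" for i l
    using that n2 by (intro measurable_component_singleton) auto
  have A_comp: "Measurable.pred ?M (\<lambda>r. A (r (1, l)) (r (2, l)))" if "l \<in> {3..n}" for l
    using measurable_compose[OF _ A, of "\<lambda>r. (r (1, l), r (2, l))" ?M] that by simp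
  have "Measurable.pred ?M (\<lambda>r. q \<le> r (1, 2) \<and> (\<forall>l\<in>{3..n}. A (r (1, l)) (r (2, l))))"
    using n2 by (intro pred_intros_logic pred_intros_finite A_comp) auto
  then have f_meas: "f \<in> borel_measurable ?M"
    unfolding f_def by simp
  have f_array: "f (overlap_array n \<sigma>) =
      of_bool (q \<le> \<sigma> 1 \<bullet> \<sigma> 2 \<and> (\<forall>l\<in>{3..n}. A (\<sigma> 1 \<bullet> \<sigma> l) (\<sigma> 2 \<bullet> \<sigma> l)))" for \<sigma> :: "nat \<Rightarrow> 'h"
  proof -
    have "overlap_array n \<sigma> (i, l) = \<sigma> i \<bullet> \<sigma> l" if "i \<in> {1, 2}" "l \<in> {2..n}" for i l
      using that n2 by (auto simp: overlap_array_def overlap_def)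
    then show ?thesis
      using n2 by (simp add: f_def)
  qed
  have card: "card {3..n} = a"
    by (simp add: n_def)
  have \<phi>: "Measurable.pred (borel \<Otimes>\<^sub>M borel) (\<lambda>S :: 'h \<times> 'h. q \<le> fst S \<bullet> snd S)"
    by measurable
  let ?E = "replica_expectation P G"
  have X: "?E (\<lambda>\<sigma>. f (overlap_array n \<sigma>)) = ?X"
    using replica_expectation_event[OF RBM, of "{3..n}", OF _ _ \<phi> pred_two_overlaps[OF A]]
    by (simp add: f_array fresh_prob_def card del: card_atLeastAtMost)
  have U: "?E (\<lambda>\<sigma>. f (overlap_array n \<sigma>) * ?\<psi> (overlap \<sigma> 1 (n + 1))) = ?U"
  proof -
    \<comment> \<open>The replica with index \<open>n + 1\<close> joins the replicas \<open>3, \<dots>, n\<close>, with a condition of its own.\<close>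
    let ?B = "\<lambda>l S (s :: 'h). if l = n + 1 then q \<le> fst S \<bullet> s else A (fst S \<bullet> s) (snd S \<bullet> s)"
    have ivl: "{3..n + 1} = insert (n + 1) {3..n}"
      using n2 by auto
    have "Measurable.pred ((borel \<Otimes>\<^sub>M borel) \<Otimes>\<^sub>M borel) (\<lambda>(S, s :: 'h). ?B l S s)" for l
      using pred_two_overlaps[OF A] pred_two_overlaps[of "\<lambda>u v. q \<le> u"] by (cases "l = n + 1") auto
    note * = replica_expectation_event[OF RBM, of "{3..n + 1}", OF _ _ \<phi> this]
    have "?E (\<lambda>\<sigma>. f (overlap_array n \<sigma>) * ?\<psi> (overlap \<sigma> 1 (n + 1))) =
        ?E (\<lambda>\<sigma>. of_bool (q \<le> fst (\<sigma> 1, \<sigma> 2) \<bullet> snd (\<sigma> 1, \<sigma> 2) \<and>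
                       (\<forall>l\<in>{3..n + 1}. ?B l (\<sigma> 1, \<sigma> 2) (\<sigma> l))))"
      unfolding ivl by (intro arg_cong[where f="?E"] ext) (auto simp: f_array overlap_def)
    also have "\<dots> = enn2real (pair_mean P G (\<lambda>\<omega> S. of_bool (q \<le> fst S \<bullet> snd S) *
        (\<Prod>l\<in>{3..n + 1}. emeasure (G \<omega>) {s. ?B l S s})))"
      by (rule *) auto
    also have "(\<lambda>\<omega> S. \<Prod>l\<in>{3..n + 1}. emeasure (G \<omega>) {s. ?B l S s}) =
        (\<lambda>\<omega> S. fresh_prob (G \<omega>) A S ^ a * fresh_prob (G \<omega>) (\<lambda>u v. q \<le> u) S)"
    proof (intro ext)
      fix \<omega> S
      have "(\<Prod>l\<in>{3..n}. emeasure (G \<omega>) {s. ?B l S s}) = (\<Prod>l\<in>{3..n}. fresh_prob (G \<omega>) A S)"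
        by (intro prod.cong) (auto simp: fresh_prob_def)
      then show "(\<Prod>l\<in>{3..n + 1}. emeasure (G \<omega>) {s. ?B l S s}) =
          fresh_prob (G \<omega>) A S ^ a * fresh_prob (G \<omega>) (\<lambda>u v. q \<le> u) S"
        unfolding ivl by (simp add: fresh_prob_def card mult.commute del: card_atLeastAtMost)
    qed
    finally show ?thesis .
  qed
  have old: "?E (\<lambda>\<sigma>. f (overlap_array n \<sigma>) * ?\<psi> (overlap \<sigma> 1 l)) = (if l = 2 \<or> b then ?X else 0)"
    if "l \<in> {2..n}" for l
  proof -
    have "f (overlap_array n \<sigma>) * ?\<psi> (overlap \<sigma> 1 l) = (if l = 2 \<or> b then f (overlap_array n \<sigma>) else 0)"
      for \<sigma> :: "nat \<Rightarrow> 'h"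
    proof (cases "l = 2")
      case False
      with that have "l \<in> {3..n}" by auto
      then have "q \<le> \<sigma> 1 \<bullet> \<sigma> l \<longleftrightarrow> b" if "\<forall>l\<in>{3..n}. A (\<sigma> 1 \<bullet> \<sigma> l) (\<sigma> 2 \<bullet> \<sigma> l)"
        using that b by blast
      then show ?thesis
        using False by (auto simp: f_array overlap_def)
    qed (auto simp: f_array overlap_def)
    then show ?thesis
      using X by (simp add: replica_expectation_def)
  qed
  have ivl2: "{2..n} = insert 2 {3..n}"
    using n2 by auto
  have "(\<Sum>l=2..n. ?E (\<lambda>\<sigma>. f (overlap_array n \<sigma>) * ?\<psi> (overlap \<sigma> 1 l))) =
      (\<Sum>l=2..n. if l = 2 \<or> b then ?X else 0)"
    by (intro sum.cong old refl)
  also have "\<dots> = ?X + (\<Sum>l\<in>{3..n}. if b then ?X else 0)"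
    unfolding ivl2 by (subst sum.insert) (auto intro!: sum.cong)
  also have "\<dots> = (1 + (if b then real a else 0)) * ?X"
    by (simp add: card algebra_simps del: card_atLeastAtMost)
  finally have "(\<Sum>l=2..n. ?E (\<lambda>\<sigma>. f (overlap_array n \<sigma>) * ?\<psi> (overlap \<sigma> 1 l))) =
      (1 + (if b then real a else 0)) * ?X" .
  moreover have "?E (\<lambda>\<sigma>. f (overlap_array n \<sigma>) * ?\<psi> (overlap \<sigma> 1 (n + 1))) =
      1 / real n * ?E (\<lambda>\<sigma>. f (overlap_array n \<sigma>)) * ?p +
      1 / real n * (\<Sum>l=2..n. ?E (\<lambda>\<sigma>. f (overlap_array n \<sigma>) * ?\<psi> (overlap \<sigma> 1 l)))"
  proof -
    have "?\<psi> \<in> borel_measurable borel" by measurable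
    moreover have "\<exists>C. \<forall>r. \<bar>f r\<bar> \<le> C" "\<exists>C. \<forall>x. \<bar>?\<psi> x\<bar> \<le> C"
      by (auto simp: f_def intro!: exI[of _ 1])
    ultimately show ?thesis
      using GG[unfolded ghirlanda_guerra_def, rule_format, OF n2 f_meas] by blast
  qed
  ultimately have "?U = 1 / real n * ?X * ?p + 1 / real n * ((1 + (if b then real a else 0)) * ?X)"
    by (simp only: U X)
  then have "real n * ?U = (?p + 1 + (if b then real a else 0)) * ?X"
    using n2 by (simp add: field_simps)
  then show ?thesis
    by (simp add: n_def)
qed

text \<open>
  The preceding lemma is applied to \<open>A(\<sigma>\<^sup>1, \<sigma>\<^sup>2)\<close> and to its mirror image \<open>A(\<sigma>\<^sup>2, \<sigma>\<^sup>1)\<close>;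
  in the difference, the unknown mean of \<open>I(R\<^sub>1\<^sub>,\<^sub>2 \<ge> q)\<close> cancels.
\<close>
lemma separating_moment_growth:
  fixes q :: real and a :: nat
  assumes GG: "ghirlanda_guerra P G"
  defines "X \<equiv> \<lambda>a. enn2real (pair_mean P G (\<lambda>\<omega> S. of_bool (q \<le> fst S \<bullet> snd S) *
      fresh_prob (G \<omega>) (\<lambda>u v. q \<le> u \<and> v < q) S ^ a))"
  shows "real a * X a \<le> (real a + 2) * X (a + 1)"
proof -
  let ?A = "\<lambda>u v. q \<le> u \<and> v < q" and ?B = "\<lambda>u v. u < q \<and> q \<le> v"
  let ?\<Phi> = "\<lambda>S :: 'h \<times> 'h. of_bool (q \<le> fst S \<bullet> snd S) :: ennreal"
  let ?x = "\<lambda>\<omega>. fresh_prob (G \<omega>) ?A" and ?y = "\<lambda>\<omega>. fresh_prob (G \<omega>) ?B"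
  let ?g1 = "\<lambda>\<omega>. fresh_prob (G \<omega>) (\<lambda>u v. q \<le> u)" and ?g2 = "\<lambda>\<omega>. fresh_prob (G \<omega>) (\<lambda>u v. q \<le> v)"
  let ?p = "replica_expectation P G (\<lambda>\<sigma>. of_bool (q \<le> overlap \<sigma> 1 2))"
  let ?U = "pair_mean P G (\<lambda>\<omega> S. ?\<Phi> S * (?x \<omega> S ^ a * ?g1 \<omega> S))"
  let ?V = "pair_mean P G (\<lambda>\<omega> S. ?\<Phi> S * (?x \<omega> S ^ a * ?g2 \<omega> S))"
  have [measurable]: "Measurable.pred (borel \<Otimes>\<^sub>M borel) (\<lambda>(u, v). ?A u v)"
    "Measurable.pred (borel \<Otimes>\<^sub>M borel) (\<lambda>(u, v). ?B u v)"
    by measurable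
  have [measurable]: "(\<lambda>z. ?x (fst z) (snd z)) \<in> borel_measurable (P \<Otimes>\<^sub>M (borel \<Otimes>\<^sub>M borel))"
    "(\<lambda>z. ?y (fst z) (snd z)) \<in> borel_measurable (P \<Otimes>\<^sub>M (borel \<Otimes>\<^sub>M borel))"
    "(\<lambda>z. ?g1 (fst z) (snd z)) \<in> borel_measurable (P \<Otimes>\<^sub>M (borel \<Otimes>\<^sub>M borel))"
    "(\<lambda>z. ?g2 (fst z) (snd z)) \<in> borel_measurable (P \<Otimes>\<^sub>M (borel \<Otimes>\<^sub>M borel))"
    by (intro measurable_fresh_prob; measurable)+
  have le1: "fresh_prob (G \<omega>) C S \<le> 1" if "\<omega> \<in> space P" for \<omega> S C
    unfolding fresh_prob_def
    by (rule prob_space.emeasure_le_1[OF random_ball_measureD(3)[OF RBM that]])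
  have fin: "pair_mean P G (\<lambda>\<omega> S. ?\<Phi> S * (?x \<omega> S ^ a * fresh_prob (G \<omega>) C S)) < top" for a C
  proof -
    have "pair_mean P G (\<lambda>\<omega> S. ?\<Phi> S * (?x \<omega> S ^ a * fresh_prob (G \<omega>) C S)) \<le> 1"
    proof (rule pair_mean_le_1[OF RBM])
      fix \<omega> S assume "\<omega> \<in> space P"
      then have "?\<Phi> S * (?x \<omega> S ^ a * fresh_prob (G \<omega>) C S) \<le> 1 * (1 * 1)"
        by (intro mult_mono power_le_one le1) auto
      then show "?\<Phi> S * (?x \<omega> S ^ a * fresh_prob (G \<omega>) C S) \<le> 1" by simp
    qed
    then show ?thesis
      using order_le_less_trans[OF _ ennreal_one_less_top] by blast
  qed
  have U: "(real a + 2) * enn2real ?U = (?p + 1 + real a) * X a"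
    using ghirlanda_guerra_moment[OF GG, of ?A q True a] by (simp add: X_def add.commute)
  have V: "(real a + 2) * enn2real ?V = (?p + 1) * X a"
  proof -
    have m1: "(\<lambda>(\<omega>, S). ?\<Phi> S * (?x \<omega> S ^ a * ?g2 \<omega> S)) \<in> borel_measurable (P \<Otimes>\<^sub>M (borel \<Otimes>\<^sub>M borel))"
      and m2: "(\<lambda>(\<omega>, S). ?\<Phi> S * ?x \<omega> S ^ a) \<in> borel_measurable (P \<Otimes>\<^sub>M (borel \<Otimes>\<^sub>M borel))"
      by (simp_all add: case_prod_beta)
    \<comment> \<open>Exchanging the replicas turns \<open>y\<close> into \<open>x\<close> and \<open>g\<^sub>1\<close> into \<open>g\<^sub>2\<close>.\<close>
    have "pair_mean P G (\<lambda>\<omega> S. ?\<Phi> S * (?y \<omega> S ^ a * ?g1 \<omega> S)) = ?V"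
      using pair_mean_swap[OF RBM m1] by (simp add: fresh_prob_swap inner_commute conj_commute)
    moreover have "pair_mean P G (\<lambda>\<omega> S. ?\<Phi> S * ?y \<omega> S ^ a) = pair_mean P G (\<lambda>\<omega> S. ?\<Phi> S * ?x \<omega> S ^ a)"
      using pair_mean_swap[OF RBM m2] by (simp add: fresh_prob_swap inner_commute conj_commute)
    ultimately show ?thesis
      using ghirlanda_guerra_moment[OF GG, of ?B q False a] by (simp add: X_def add.commute)
  qed
  have "?U \<le> pair_mean P G (\<lambda>\<omega> S. ?\<Phi> S * (?x \<omega> S ^ a * ?g2 \<omega> S) + ?\<Phi> S * (?x \<omega> S ^ a * ?x \<omega> S))"
  proof (rule pair_mean_mono[OF RBM])
    fix \<omega> S assume \<omega>: "\<omega> \<in> space P"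
    have "?g1 \<omega> S \<le> emeasure (G \<omega>) ({s. q \<le> snd S \<bullet> s} \<union> {s. q \<le> fst S \<bullet> s \<and> snd S \<bullet> s < q})"
      unfolding fresh_prob_def by (rule emeasure_mono) (auto simp: random_ball_measureD(4)[OF RBM \<omega>])
    also have "\<dots> \<le> ?g2 \<omega> S + ?x \<omega> S"
      unfolding fresh_prob_def
      by (rule emeasure_subadditive) (simp_all add: random_ball_measureD(4)[OF RBM \<omega>])
    finally have "?\<Phi> S * (?x \<omega> S ^ a * ?g1 \<omega> S) \<le> ?\<Phi> S * (?x \<omega> S ^ a * (?g2 \<omega> S + ?x \<omega> S))"
      by (intro mult_left_mono) auto
    then show "?\<Phi> S * (?x \<omega> S ^ a * ?g1 \<omega> S) \<le>
        ?\<Phi> S * (?x \<omega> S ^ a * ?g2 \<omega> S) + ?\<Phi> S * (?x \<omega> S ^ a * ?x \<omega> S)"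
      by (simp add: distrib_left)
  qed
  also have "\<dots> = ?V + pair_mean P G (\<lambda>\<omega> S. ?\<Phi> S * (?x \<omega> S ^ a * ?x \<omega> S))"
    by (rule pair_mean_add[OF RBM]) (simp_all add: case_prod_beta)
  finally have "enn2real ?U \<le> enn2real (?V + pair_mean P G (\<lambda>\<omega> S. ?\<Phi> S * (?x \<omega> S ^ a * ?x \<omega> S)))"
    using fin by (intro enn2real_mono) auto
  also have "\<dots> = enn2real ?V + X (a + 1)"
    using fin by (simp add: enn2real_plus X_def mult.commute)
  finally have "(real a + 2) * enn2real ?U \<le> (real a + 2) * (enn2real ?V + X (a + 1))"
    by (intro mult_left_mono) auto
  then have "(?p + 1 + real a) * X a \<le> (?p + 1) * X a + (real a + 2) * X (a + 1)"
    by (simp only: distrib_left U V)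
  then show ?thesis
    by (simp add: algebra_simps)
qed

end

section \<open>Vanishing of the first moment\<close>

text \<open>
  The growth condition makes \<open>a (a + 1) X a\<close> nondecreasing, hence \<open>(a + 1) X a\<close> is at least
  \<open>2 X 1 / a\<close> for \<open>a \<ge> 1\<close>, and its sum is bounded only if \<open>X 1 = 0\<close>.
\<close>
lemma first_moment_eq_0:
  fixes X :: "nat \<Rightarrow> real"
  assumes nonneg: "\<And>a. 0 \<le> X a"
    and growth: "\<And>a. real a * X a \<le> (real a + 2) * X (a + 1)"
    and bound: "\<And>N. (\<Sum>a<N. (real a + 1) * X a) \<le> C"
  shows "X 1 = 0"
proof (rule ccontr)
  assume "X 1 \<noteq> 0"
  have ge: "2 * X 1 \<le> (real k + 1) * ((real k + 2) * X (k + 1))" for k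
  proof (induction k)
    case (Suc k)
    have "(real k + 2) * ((real k + 1) * X (k + 1)) \<le> (real k + 2) * ((real k + 3) * X (k + 2))"
      using growth[of "k + 1"] by (intro mult_left_mono) (auto simp: add_ac)
    with Suc show ?case
      by (simp add: algebra_simps)
  qed simp
  have "summable (\<lambda>a. (real a + 1) * X a)"
    by (rule summableI_nonneg_bounded[OF _ bound]) (simp add: nonneg)
  then have "summable (\<lambda>k. (real (Suc k) + 1) * X (Suc k))"
    by (subst summable_Suc_iff)
  then have "summable (\<lambda>k. 2 * X 1 * inverse (real (Suc k)))"
  proof (rule summable_comparison_test')
    fix k :: nat
    show "norm (2 * X 1 * inverse (real (Suc k))) \<le> (real (Suc k) + 1) * X (Suc k)"
      using ge[of k] nonneg[of 1] by (simp add: field_simps)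
  qed
  then have "summable (\<lambda>k. inverse (real (Suc k)))"
    using \<open>X 1 \<noteq> 0\<close> by (simp only: summable_cmult_iff) simp
  then show False
    using not_summable_harmonic[where 'a=real] by (subst (asm) summable_Suc_iff) auto
qed

text \<open>At \<open>x = 1\<close> the right-hand side is infinite.\<close>
lemma sum_Suc_power_le_inverse_square:
  fixes x :: ennreal
  assumes "x \<le> 1"
  shows "(\<Sum>a<N. of_nat (a + 1) * x ^ a) \<le> 1 / (1 - x)\<^sup>2"
proof (cases "x = 1")
  case True
  then show ?thesis by (simp add: ennreal_divide_zero)
next
  case False
  with assms obtain r where r: "x = ennreal r" "0 \<le> r" "r < 1"
    by (cases x) (auto simp: less_le top_unique)
  \<comment> \<open>The closed form of the partial sum falls short of \<open>(1 - r)\<^sup>-\<^sup>2\<close> by a nonnegative remainder.\<close>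
  have "(1 - r)\<^sup>2 * (\<Sum>a<N. real (a + 1) * r ^ a) = 1 - r ^ N * (1 + real N * (1 - r))"
    by (induction N) (auto simp: algebra_simps power2_eq_square)
  also have "\<dots> \<le> 1"
    using r by simp
  finally have "(\<Sum>a<N. real (a + 1) * r ^ a) \<le> 1 / (1 - r)\<^sup>2"
    using r by (simp add: pos_le_divide_eq mult.commute)
  then have "ennreal (\<Sum>a<N. real (a + 1) * r ^ a) \<le> ennreal (1 / (1 - r)\<^sup>2)"
    by (rule ennreal_leI)
  also have "ennreal (1 / (1 - r)\<^sup>2) = 1 / (1 - x)\<^sup>2"
    using r by (simp add: ennreal_minus ennreal_power divide_ennreal flip: ennreal_1)
  also have "ennreal (\<Sum>a<N. real (a + 1) * r ^ a) = (\<Sum>a<N. of_nat (a + 1) * x ^ a)"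
    using r by (simp add: sum_ennreal[symmetric] ennreal_mult ennreal_power ennreal_of_nat_eq_real_of_nat
        del: sum_ennreal of_nat_Suc of_nat_add)
  finally show ?thesis .
qed

section \<open>The three-replica event\<close>

theorem theorem2:
  fixes P :: "'w measure"
    and G :: "'w \<Rightarrow> 'h::{real_inner, polish_space} measure"
    and q :: real
  assumes "random_ball_measure P G"
    and "ghirlanda_guerra P G"
    and "(\<integral>\<^sup>+\<omega>. (\<integral>\<^sup>+\<sigma>. separation_ratio q (G \<omega>) \<sigma> \<partial>replicas {1..} (G \<omega>)) \<partial>P) < \<infinity>"
  shows "AE \<omega> in P. emeasure (replicas {1..3} (G \<omega>))
           {\<sigma> \<in> space (replicas {1..3} (G \<omega>)).
              overlap \<sigma> 1 2 \<ge> q \<and> overlap \<sigma> 1 3 \<ge> q \<and> overlap \<sigma> 2 3 < q} = 0"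
proof -
  note RBM = assms(1)
  let ?A = "\<lambda>u v. q \<le> u \<and> v < q"
  let ?\<Phi> = "\<lambda>S :: 'h \<times> 'h. of_bool (q \<le> fst S \<bullet> snd S) :: ennreal"
  let ?x = "\<lambda>\<omega>. fresh_prob (G \<omega>) ?A"
  let ?m = "\<lambda>a. pair_mean P G (\<lambda>\<omega> S. ?\<Phi> S * ?x \<omega> S ^ a)"
  define X where "X = (\<lambda>a. enn2real (?m a))"
  have predA: "Measurable.pred (borel \<Otimes>\<^sub>M borel) (\<lambda>(u, v). ?A u v)"
    by measurable
  have [measurable]: "(\<lambda>z. ?x (fst z) (snd z)) \<in> borel_measurable (P \<Otimes>\<^sub>M (borel \<Otimes>\<^sub>M borel))"
    by (rule measurable_fresh_prob[OF RBM predA])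
  have m_meas: "(\<lambda>(\<omega>, S). ?\<Phi> S * ?x \<omega> S ^ a) \<in> borel_measurable (P \<Otimes>\<^sub>M (borel \<Otimes>\<^sub>M borel))" for a
    by (simp add: case_prod_beta)
  have x_le_1: "?x \<omega> S \<le> 1" if "\<omega> \<in> space P" for \<omega> S
    unfolding fresh_prob_def
    by (rule prob_space.emeasure_le_1[OF random_ball_measureD(3)[OF RBM that]])
  have m_le_1: "?m a \<le> 1" for a
  proof (rule pair_mean_le_1[OF RBM])
    fix \<omega> S assume "\<omega> \<in> space P"
    then have "?\<Phi> S * ?x \<omega> S ^ a \<le> 1 * 1"
      by (intro mult_mono power_le_one x_le_1) auto
    then show "?\<Phi> S * ?x \<omega> S ^ a \<le> 1" by simp
  qed
  have m_eq: "?m a = ennreal (X a)" for a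
    using order_le_less_trans[OF m_le_1[of a] ennreal_one_less_top] by (simp add: X_def)
  let ?r = "\<lambda>\<omega> S. ?\<Phi> S / (1 - ?x \<omega> S)\<^sup>2"
  define I where "I = pair_mean P G ?r"
  have "I = (\<integral>\<^sup>+\<omega>. (\<integral>\<^sup>+\<sigma>. separation_ratio q (G \<omega>) \<sigma> \<partial>replicas {1..} (G \<omega>)) \<partial>P)"
    unfolding I_def pair_mean_def
  proof (rule nn_integral_cong)
    fix \<omega> assume \<omega>: "\<omega> \<in> space P"
    have "(\<lambda>(\<omega>, S). ?r \<omega> S) \<in> borel_measurable (P \<Otimes>\<^sub>M (borel \<Otimes>\<^sub>M borel))"
      by (simp add: case_prod_beta)
    then have "?r \<omega> \<in> borel_measurable (G \<omega> \<Otimes>\<^sub>M G \<omega>)"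
      by (rule pair_section_measurable[OF RBM _ \<omega>])
    from nn_integral_replicas[OF random_ball_measureD(3)[OF RBM \<omega>], where J="{}" and I="{1..}", OF _ _ _ _ this]
    have "(\<integral>\<^sup>+S. ?r \<omega> S \<partial>(G \<omega> \<Otimes>\<^sub>M G \<omega>)) = (\<integral>\<^sup>+\<sigma>. ?r \<omega> (\<sigma> 1, \<sigma> 2) \<partial>replicas {1..} (G \<omega>))"
      by simp
    also have "\<dots> = (\<integral>\<^sup>+\<sigma>. separation_ratio q (G \<omega>) \<sigma> \<partial>replicas {1..} (G \<omega>))"
      by (simp only: separation_ratio_def overlap_def emeasure_separating_set[symmetric]
          fst_conv snd_conv indicator_def atLeast_iff)
    finally show "(\<integral>\<^sup>+S. ?r \<omega> S \<partial>(G \<omega> \<Otimes>\<^sub>M G \<omega>)) =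
        (\<integral>\<^sup>+\<sigma>. separation_ratio q (G \<omega>) \<sigma> \<partial>replicas {1..} (G \<omega>))" .
  qed
  with assms(3) have I_fin: "I < top" by simp
  have bound: "(\<Sum>a<N. (real a + 1) * X a) \<le> enn2real I" for N
  proof -
    have "ennreal (\<Sum>a<N. (real a + 1) * X a) = (\<Sum>a<N. of_nat (a + 1) * ?m a)"
      unfolding m_eq
      by (subst sum_ennreal[symmetric])
        (auto simp: X_def ennreal_mult ennreal_of_nat_eq_real_of_nat add.commute
          simp del: of_nat_add of_nat_Suc simp flip: of_nat_Suc intro!: sum.cong)
    also have "\<dots> = pair_mean P G (\<lambda>\<omega> S. \<Sum>a<N. of_nat (a + 1) * (?\<Phi> S * ?x \<omega> S ^ a))"
      by (rule pair_mean_weighted_sum[OF RBM m_meas, symmetric])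
    also have "\<dots> \<le> I"
      unfolding I_def
    proof (rule pair_mean_mono[OF RBM])
      fix \<omega> S assume "\<omega> \<in> space P"
      from sum_Suc_power_le_inverse_square[OF x_le_1[OF this]]
      show "(\<Sum>a<N. of_nat (a + 1) * (?\<Phi> S * ?x \<omega> S ^ a)) \<le> ?r \<omega> S"
        by (cases "q \<le> fst S \<bullet> snd S") auto
    qed
    finally have "enn2real (ennreal (\<Sum>a<N. (real a + 1) * X a)) \<le> enn2real I"
      by (rule enn2real_mono) (rule I_fin)
    moreover have "0 \<le> (\<Sum>a<N. (real a + 1) * X a)"
      by (intro sum_nonneg) (simp add: X_def)
    ultimately show ?thesis
      by simp
  qed
  have "X 1 = 0"
    using separating_moment_growth[OF RBM assms(2), of _ q] bound
    by (intro first_moment_eq_0[of X]) (auto simp: X_def)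
  then have "?m 1 = 0"
    unfolding m_eq by simp
  then have "AE \<omega> in P. (\<integral>\<^sup>+S. ?\<Phi> S * ?x \<omega> S ^ 1 \<partial>(G \<omega> \<Otimes>\<^sub>M G \<omega>)) = 0"
    unfolding pair_mean_def
    by (subst (asm) nn_integral_0_iff_AE) (rule pair_integral_measurable[OF RBM m_meas])
  then show ?thesis
  proof (rule AE_mp, intro AE_I2 impI)
    fix \<omega> assume \<omega>: "\<omega> \<in> space P" and 0: "(\<integral>\<^sup>+S. ?\<Phi> S * ?x \<omega> S ^ 1 \<partial>(G \<omega> \<Otimes>\<^sub>M G \<omega>)) = 0"
    let ?R = "replicas {1..3} (G \<omega>)"
    let ?T = "{\<sigma> \<in> space ?R. overlap \<sigma> 1 2 \<ge> q \<and> overlap \<sigma> 1 3 \<ge> q \<and> overlap \<sigma> 2 3 < q}"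
    note sG[measurable_cong] = random_ball_measureD(4)[OF RBM \<omega>]
    have [measurable]: "(\<lambda>\<sigma>. \<sigma> i) \<in> borel_measurable ?R" if "i \<in> {1..3}" for i
      unfolding replicas_def using measurable_component_singleton[OF that, of "\<lambda>_. G \<omega>"]
      by (simp add: measurable_cong_sets[OF refl sG])
    have "?T \<in> sets ?R"
      unfolding overlap_def by measurable
    then have "emeasure ?R ?T = (\<integral>\<^sup>+\<sigma>. indicator ?T \<sigma> \<partial>?R)"
      by simp
    also have "\<dots> = (\<integral>\<^sup>+\<sigma>. ?\<Phi> (\<sigma> 1, \<sigma> 2) *
        (\<Prod>l\<in>{3}. of_bool (?A (fst (\<sigma> 1, \<sigma> 2) \<bullet> \<sigma> l) (snd (\<sigma> 1, \<sigma> 2) \<bullet> \<sigma> l))) \<partial>?R)"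
      by (intro nn_integral_cong) (simp add: overlap_def indicator_def)
    also have "\<dots> = (\<integral>\<^sup>+S. ?\<Phi> S *
        (\<Prod>l\<in>{3::nat}. \<integral>\<^sup>+s. of_bool (?A (fst S \<bullet> s) (snd S \<bullet> s)) \<partial>G \<omega>) \<partial>(G \<omega> \<Otimes>\<^sub>M G \<omega>))"
    proof (rule nn_integral_replicas)
      have "(\<lambda>(S, s :: 'h). of_bool (?A (fst S \<bullet> s) (snd S \<bullet> s)) :: ennreal) \<in>
          borel_measurable ((borel \<Otimes>\<^sub>M borel) \<Otimes>\<^sub>M borel)"
        using pred_two_overlaps[OF predA] by (simp add: case_prod_beta)
      then show "(\<lambda>(S, s :: 'h). of_bool (?A (fst S \<bullet> s) (snd S \<bullet> s)) :: ennreal) \<in>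
          borel_measurable ((G \<omega> \<Otimes>\<^sub>M G \<omega>) \<Otimes>\<^sub>M G \<omega>)"
        by measurable
    qed (use random_ball_measureD(3)[OF RBM \<omega>] in auto)
    also have "\<dots> = (\<integral>\<^sup>+S. ?\<Phi> S * ?x \<omega> S ^ 1 \<partial>(G \<omega> \<Otimes>\<^sub>M G \<omega>))"
    proof (intro nn_integral_cong arg_cong2[where f="(*)"] refl)
      fix S :: "'h \<times> 'h"
      have "{s. ?A (fst S \<bullet> s) (snd S \<bullet> s)} \<in> sets (G \<omega>)"
        by (simp add: sG)
      then have "?x \<omega> S = (\<integral>\<^sup>+s. indicator {s. ?A (fst S \<bullet> s) (snd S \<bullet> s)} s \<partial>G \<omega>)"
        by (simp add: fresh_prob_def)
      then show "(\<Prod>l\<in>{3::nat}. \<integral>\<^sup>+s. of_bool (?A (fst S \<bullet> s) (snd S \<bullet> s)) \<partial>G \<omega>) = ?x \<omega> S ^ 1"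
        by (simp add: indicator_def)
    qed
    finally show "emeasure ?R ?T = 0"
      using 0 by simp
  qed
qed

end
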